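(* Let $g\ge 1$, let $C$ be a nonseparating simple closed curve in the closed orientable surface $S_{g+1}$ of genus $g+1$, and let $t_C$ be the left-handed Dehn twist about $C$. Let $n>1$ and $1\le\ell<n$ be integers, and suppose that $h\in\mathrm{Mod}(S_{g+1})$ is a side-preserving fractional power of $t_C$ of exponent $\ell/\!/n$ given by the SP data set $D=((\ell,n),g_0,(a,b);(c_1,n_1),\dots,(c_m,n_m))$ (of genus $g$). Then: (a) $n\le 4g$; (b) $n<g$ whenever $g_0\ge 1$; (c) $m=1$ whenever $n>2g$.
   Context: $\mathrm{Mod}(S)$ is the mapping class group of the closed oriented surface $S$. A fractional power of $t_C$ of exponent $\ell/\!/n$ (a formal symbol recording the pair $(\ell,n)$) is an $h\in\mathrm{Mod}(S)$ with $h^n=t_C^{\ell}$. Such an $h$ preserves the isotopy class of $C$, so one may take a representative with $h(C)=C$. It is side-exchanging if it interchanges the two sides of $C$, and side-preserving otherwise. An SP data set of exponent $\ell/\!/n$ is a tuple $((\ell,n),g_0,(a,b);(c_1,n_1),\dots,(c_m,n_m))$ where: (i) $\ell,n,g_0$ and the $n_i$ are integers with $n>1$, $g_0\ge 0$, each $n_i>1$, and each $n_i$ divides $n$; (ii) $a$ and $b$ are residues modulo $n$ with $\gcd(a,n)=\gcd(b,n)=1$, and each $c_i$ is a residue modulo $n_i$ with $\gcd(c_i,n_i)=1$; (iii) $a+b\equiv \ell ab \pmod n$; (iv) $a+b+\sum_{i=1}^m \frac{n}{n_i}c_i\equiv 0 \pmod n$. Its genus is $g=g_0n+\frac12\sum_{i=1}^m\frac{n}{n_i}(n_i-1)$.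 Two SP data sets are considered the same if they differ by interchanging $a$ and $b$ or by reordering the pairs $(c_i,n_i)$. The data set (of genus $g$) giving the conjugacy class of $h$: remove an invariant open annular neighborhood of $C$ and cap off the two resulting boundary circles with disks with centers $P,Q$, obtaining $S_g$; $h$ induces a generator $t$ of a $C_n$-action on $S_g$ fixing $P$ and $Q$. The quotient orbifold has genus $g_0$, two cone points of order $n$ (the images of $P,Q$) and $m$ other cone points of orders $n_1,\dots,n_m$. The residue $a$ (resp. $b$) is the inverse modulo $n$ of $k$, where $2\pi k/n$ is the rotation angle of $t$ at $P$ (resp. $Q$), and $c_i$ is the inverse modulo $n_i$ of $c_i'$, where $2\pi c_i'/n_i$ is the rotation angle of $t^{n/n_i}$ at the points over the $i$-th other cone point. *)

theory Defs
  imports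
    "HOL-Complex_Analysis.Winding_Numbers"
    "HOL-Algebra.Coset"
    "HOL-Algebra.Bij"
    "HOL-Number_Theory.Cong"
begin

section \<open>Closed oriented surfaces\<close>

text \<open>
  An injective continuous map between open subsets of the plane preserves the orientation if it
  sends small positively oriented circles to curves of winding number 1 around the image of the
  centre (the alternative being -1).
\<close>

definition planar_orientation_preserving :: "complex set \<Rightarrow> (complex \<Rightarrow> complex) \<Rightarrow> bool" where
  "planar_orientation_preserving U f \<longleftrightarrow>
     (\<forall>z r. 0 < r \<and> cball z r \<subseteq> U \<longrightarrow> winding_number (f \<circ> circlepath z r) (f z) = 1)"

text \<open>
  The orientation of a surface is given by an atlas of parametrizations by the whole plane
  (inverses of charts), with orientation preserving transition maps.
\<close>

record 'a oriented_surface =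
  surface_top :: "'a topology"
  atlas :: "(complex \<Rightarrow> 'a) set"

definition oriented_embedding :: "'a oriented_surface \<Rightarrow> complex set \<Rightarrow> (complex \<Rightarrow> 'a) \<Rightarrow> bool" where
  "oriented_embedding S U \<phi> \<longleftrightarrow>
     open U \<and>
     embedding_map (top_of_set U) (surface_top S) \<phi> \<and> openin (surface_top S) (\<phi> ` U) \<and>
     (\<forall>\<psi>\<in>atlas S. planar_orientation_preserving (U \<inter> \<phi> -` range \<psi>) (inv_into UNIV \<psi> \<circ> \<phi>))"

text \<open>Second countability follows from compactness.\<close>

definition closed_oriented_surface :: "'a oriented_surface \<Rightarrow> bool" where
  "closed_oriented_surface S \<longleftrightarrow>
     compact_space (surface_top S) \<and> Hausdorff_space (surface_top S) \<and>
     connected_space (surface_top S) \<and> topspace (surface_top S) \<noteq> {} \<and>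
     (\<forall>\<phi>\<in>atlas S. oriented_embedding S UNIV \<phi>) \<and>
     (\<Union>\<phi>\<in>atlas S. range \<phi>) = topspace (surface_top S)"

definition simple_closed_curve :: "'a topology \<Rightarrow> 'a set \<Rightarrow> bool" where
  "simple_closed_curve X C \<longleftrightarrow>
     C \<subseteq> topspace X \<and> subtopology X C homeomorphic_space top_of_set (sphere (0::complex) 1)"

definition nonseparating :: "'a topology \<Rightarrow> 'a set \<Rightarrow> bool" where
  "nonseparating X A \<longleftrightarrow> connected_space (subtopology X (topspace X - A))"

text \<open>
  The genus is the largest number of disjoint simple closed curves whose union does not separate.
\<close>

definition cut_system :: "'a topology \<Rightarrow> 'a set set \<Rightarrow> bool" where
  "cut_system X \<C> \<longleftrightarrow>
     finite \<C> \<and> (\<forall>C\<in>\<C>. simple_closed_curve X C) \<and> pairwise disjnt \<C> \<and> nonseparating X (\<Union>\<C>)"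

definition has_genus :: "'a topology \<Rightarrow> nat \<Rightarrow> bool" where
  "has_genus X g \<longleftrightarrow>
     (\<exists>\<C>. cut_system X \<C> \<and> card \<C> = g) \<and> (\<forall>\<C>. cut_system X \<C> \<longrightarrow> card \<C> \<le> g)"

section \<open>The mapping class group\<close>

text \<open>
  A homeomorphism defined on \<open>M\<close> preserves the orientation if it does so on every
  embedded open disk contained in \<open>M\<close>.
\<close>

definition orientation_preserving_on ::
    "'a oriented_surface \<Rightarrow> 'a set \<Rightarrow> 'b oriented_surface \<Rightarrow> ('a \<Rightarrow> 'b) \<Rightarrow> bool" where
  "orientation_preserving_on S M R f \<longleftrightarrow>
     (\<forall>\<phi>. oriented_embedding S UNIV \<phi> \<and> range \<phi> \<subseteq> M \<longrightarrow> oriented_embedding R UNIV (f \<circ> \<phi>))"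

definition homeo_group :: "'a oriented_surface \<Rightarrow> ('a \<Rightarrow> 'a) monoid" where
  "homeo_group S =
     (BijGroup (topspace (surface_top S)))
       \<lparr>carrier := {f \<in> Bij (topspace (surface_top S)).
          homeomorphic_map (surface_top S) (surface_top S) f \<and>
          orientation_preserving_on S (topspace (surface_top S)) S f}\<rparr>"

text \<open>Isotopy is homotopy through homeomorphisms.\<close>

definition isotopic_to_id :: "'a oriented_surface \<Rightarrow> ('a \<Rightarrow> 'a) set" where
  "isotopic_to_id S =
     {f \<in> carrier (homeo_group S).
        homotopic_with (homeomorphic_map (surface_top S) (surface_top S))
          (surface_top S) (surface_top S) f \<one>\<^bsub>homeo_group S\<^esub>}"

text \<open>A mapping class is thus a set of homeomorphisms, namely the set of its representatives.\<close>

definition Mod_group :: "'a oriented_surface \<Rightarrow> ('a \<Rightarrow> 'a) set monoid" where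
  "Mod_group S = homeo_group S Mod isotopic_to_id S"

section \<open>Dehn twists and their fractional powers\<close>

text \<open>
  An annular neighborhood of \<open>C\<close> is parametrized by the punctured plane, with \<open>C\<close> the image of the
  circle of radius 3/2.  The annulus \<open>1 < cmod z < 2\<close> is then an open annular neighborhood of \<open>C\<close>
  whose boundary consists of the two circles of radius 1 and 2.
\<close>

definition annular_chart :: "'a oriented_surface \<Rightarrow> 'a set \<Rightarrow> (complex \<Rightarrow> 'a) \<Rightarrow> bool" where
  "annular_chart S C e \<longleftrightarrow> oriented_embedding S (- {0}) e \<and> e ` sphere 0 (3/2) = C"

definition open_annulus :: "(complex \<Rightarrow> 'a) \<Rightarrow> 'a set" where
  "open_annulus e = e ` {z. 1 < cmod z \<and> cmod z < 2}"

text \<open>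
  In polar coordinates the model twist is \<open>(r, \<theta>) \<mapsto> (r, \<theta> + 2 * pi * (r - 1))\<close>.  It turns a
  transverse arc crossing the annulus in either direction to the left.
\<close>

definition twist_model :: "complex \<Rightarrow> complex" where
  "twist_model z = z * cis (2 * pi * (cmod z - 1))"

definition twist_homeo :: "'a oriented_surface \<Rightarrow> (complex \<Rightarrow> 'a) \<Rightarrow> 'a \<Rightarrow> 'a" where
  "twist_homeo S e =
     (\<lambda>x \<in> topspace (surface_top S).
        if x \<in> open_annulus e then e (twist_model (inv_into (- {0}) e x)) else x)"

definition left_dehn_twist :: "'a oriented_surface \<Rightarrow> 'a set \<Rightarrow> ('a \<Rightarrow> 'a) set \<Rightarrow> bool" where
  "left_dehn_twist S C tC \<longleftrightarrow>
     (\<exists>e. annular_chart S C e \<and> tC = isotopic_to_id S #>\<^bsub>homeo_group S\<^esub> twist_homeo S e)"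

definition fractional_power ::
    "'a oriented_surface \<Rightarrow> ('a \<Rightarrow> 'a) set \<Rightarrow> int \<Rightarrow> nat \<Rightarrow> ('a \<Rightarrow> 'a) set \<Rightarrow> bool" where
  "fractional_power S tC l n h \<longleftrightarrow>
     h \<in> carrier (Mod_group S) \<and> h [^]\<^bsub>Mod_group S\<^esub> n = tC [^]\<^bsub>Mod_group S\<^esub> l"

text \<open>
  A homeomorphism preserving \<open>C\<close> interchanges its sides if it maps a thin collar on each side of
  \<open>C\<close> to the other side.
\<close>

definition interchanges_sides :: "'a oriented_surface \<Rightarrow> 'a set \<Rightarrow> ('a \<Rightarrow> 'a) \<Rightarrow> bool" where
  "interchanges_sides S C H \<longleftrightarrow>
     (\<exists>e \<epsilon>. annular_chart S C e \<and> 0 < \<epsilon> \<and> \<epsilon> < 1 \<and>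
        H ` e ` {z. 3/2 - \<epsilon> < cmod z \<and> cmod z < 3/2} \<subseteq> e ` {z. 3/2 < cmod z} \<and>
        H ` e ` {z. 3/2 < cmod z \<and> cmod z < 3/2 + \<epsilon>} \<subseteq> e ` {z. 0 < cmod z \<and> cmod z < 3/2})"

definition side_preserving :: "'a oriented_surface \<Rightarrow> 'a set \<Rightarrow> ('a \<Rightarrow> 'a) set \<Rightarrow> bool" where
  "side_preserving S C h \<longleftrightarrow> (\<exists>H\<in>h. H ` C = C \<and> \<not> interchanges_sides S C H)"

section \<open>SP data sets\<close>

text \<open>
  The tuple \<open>((l, n), g0, (a, b), [(c1, n1), \<dots>, (cm, nm)])\<close>.  Residues are given by integer
  representatives, of which only the residue class matters.
\<close>

type_synonym sp_data = "(int \<times> nat) \<times> nat \<times> (int \<times> int) \<times> (int \<times> nat) list"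

fun sp_data_set :: "sp_data \<Rightarrow> bool" where
  "sp_data_set ((l, n), g0, (a, b), cs) \<longleftrightarrow>
     n > 1 \<and> (\<forall>(c, k) \<in> set cs. k > 1 \<and> k dvd n) \<and>
     coprime a (int n) \<and> coprime b (int n) \<and> (\<forall>(c, k) \<in> set cs. coprime c (int k)) \<and>
     [a + b = l * a * b] (mod int n) \<and>
     [a + b + (\<Sum>(c, k)\<leftarrow>cs. int (n div k) * c) = 0] (mod int n)"

fun sp_genus :: "sp_data \<Rightarrow> real" where
  "sp_genus ((l, n), g0, (a, b), cs) =
     real g0 * real n + 1/2 * (\<Sum>(c, k)\<leftarrow>cs. real n / real k * (real k - 1))"

section \<open>The data set of a side-preserving fractional power\<close>

text \<open>
  \<open>j\<close> identifies the complement of the open annulus in \<open>S\<close> with a subsurface of the closed surface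
  \<open>R\<close> whose complement consists of the interiors of two disjoint closed disks with centers \<open>P\<close> and
  \<open>Q\<close>, bounded by the two boundary circles of the annulus.
\<close>

definition capped_surface ::
    "'a oriented_surface \<Rightarrow> (complex \<Rightarrow> 'a) \<Rightarrow> 'b oriented_surface \<Rightarrow> ('a \<Rightarrow> 'b) \<Rightarrow> 'b \<Rightarrow> 'b \<Rightarrow> bool" where
  "capped_surface S e R j P Q \<longleftrightarrow>
     (let M = topspace (surface_top S) - open_annulus e in
        closed_oriented_surface R \<and>
        embedding_map (subtopology (surface_top S) M) (surface_top R) j \<and>
        orientation_preserving_on S M R j \<and>
        (\<exists>dP dQ. oriented_embedding R UNIV dP \<and> oriented_embedding R UNIV dQ \<and>
           dP 0 = P \<and> dQ 0 = Q \<and>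
           dP ` cball 0 1 \<inter> dQ ` cball 0 1 = {} \<and>
           j ` M = topspace (surface_top R) - (dP ` ball 0 1 \<union> dQ ` ball 0 1) \<and>
           dP ` sphere 0 1 = j ` e ` sphere 0 1 \<and> dQ ` sphere 0 1 = j ` e ` sphere 0 2))"

definition generates_cyclic_action :: "'a oriented_surface \<Rightarrow> nat \<Rightarrow> ('a \<Rightarrow> 'a) \<Rightarrow> bool" where
  "generates_cyclic_action R n t \<longleftrightarrow>
     t \<in> carrier (homeo_group R) \<and>
     (\<forall>x\<in>topspace (surface_top R). (t ^^ n) x = x) \<and>
     (\<forall>k. 0 < k \<and> k < n \<longrightarrow> (\<exists>x\<in>topspace (surface_top R). (t ^^ k) x \<noteq> x))"

definition cyclic_orbit :: "('a \<Rightarrow> 'a) \<Rightarrow> 'a \<Rightarrow> 'a set" where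
  "cyclic_orbit t x = range (\<lambda>k. (t ^^ k) x)"

definition stabilizer_order :: "nat \<Rightarrow> ('a \<Rightarrow> 'a) \<Rightarrow> 'a \<Rightarrow> nat" where
  "stabilizer_order n t x = card {k. k < n \<and> (t ^^ k) x = x}"

text \<open>The rotation angle of \<open>f\<close> at the fixed point \<open>x\<close> is \<open>2 * pi * k / n\<close>.\<close>

definition rotation_angle :: "'a oriented_surface \<Rightarrow> ('a \<Rightarrow> 'a) \<Rightarrow> 'a \<Rightarrow> int \<Rightarrow> nat \<Rightarrow> bool" where
  "rotation_angle R f x k n \<longleftrightarrow>
     (\<exists>d. oriented_embedding R UNIV d \<and> d 0 = x \<and>
        (\<forall>z. f (d z) = d (cis (2 * pi * real_of_int k / real n) * z)))"

text \<open>
  The quotient orbifold has the orbits as its points.  \<open>os\<close> lists its cone points other than the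
  images of \<open>P\<close> and \<open>Q\<close>.
\<close>

definition action_data ::
    "'a oriented_surface \<Rightarrow> nat \<Rightarrow> ('a \<Rightarrow> 'a) \<Rightarrow> 'a \<Rightarrow> 'a \<Rightarrow> nat \<Rightarrow> int \<Rightarrow> int \<Rightarrow> (int \<times> nat) list \<Rightarrow> bool" where
  "action_data R n t P Q g0 a b cs \<longleftrightarrow>
     (\<exists>B :: 'a set topology. quotient_map (surface_top R) B (cyclic_orbit t) \<and> has_genus B g0) \<and>
     (\<exists>k. rotation_angle R t P k n \<and> [a * k = 1] (mod int n)) \<and>
     (\<exists>k. rotation_angle R t Q k n \<and> [b * k = 1] (mod int n)) \<and>
     (\<exists>os. length os = length cs \<and> distinct os \<and>
        set os = cyclic_orbit t `
          {x \<in> topspace (surface_top R). x \<noteq> P \<and> x \<noteq> Q \<and> stabilizer_order n t x > 1} \<and>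
        (\<forall>i < length cs. case cs ! i of (c, ni) \<Rightarrow>
           \<forall>x \<in> os ! i. stabilizer_order n t x = ni \<and>
             (\<exists>c'. rotation_angle R (t ^^ (n div ni)) x c' ni \<and> [c * c' = 1] (mod int ni))))"

text \<open>
  \<open>H\<close> is a representative of \<open>h\<close> preserving \<open>C\<close> and an annular neighborhood of it, and inducing \<open>t\<close>
  on the capped surface \<open>R\<close>.  That the points of \<open>R\<close> are taken from the same type as those of \<open>S\<close> is
  no restriction: all surfaces have the cardinality of the continuum.  Since \<open>P\<close> and \<open>Q\<close> may be named
  in either order and \<open>os\<close> may be enumerated in any order, this depends only on the data set up to
  interchanging \<open>a\<close> and \<open>b\<close> and reordering the pairs.
\<close>

fun given_by_data_set :: "'a oriented_surface \<Rightarrow> 'a set \<Rightarrow> ('a \<Rightarrow> 'a) set \<Rightarrow> sp_data \<Rightarrow> bool" where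
  "given_by_data_set S C h ((l, n), g0, (a, b), cs) \<longleftrightarrow>
     sp_data_set ((l, n), g0, (a, b), cs) \<and>
     (\<exists>H e (R :: 'a oriented_surface) j P Q t.
        H \<in> h \<and> H ` C = C \<and>
        annular_chart S C e \<and> H ` open_annulus e = open_annulus e \<and>
        capped_surface S e R j P Q \<and>
        generates_cyclic_action R n t \<and>
        (\<forall>x \<in> topspace (surface_top S) - open_annulus e. t (j x) = j (H x)) \<and>
        t P = P \<and> t Q = Q \<and>
        action_data R n t P Q g0 a b cs)"

end

(* If there were no cone points (c_i, n_i), conditions (iii) and (iv) would give l a b = 0 modulo n,
   so n would divide l.  Hence m is at least 1.  Each cone point contributes at least n/4 to
   the genus, so g is at least g_0 n + m n / 4, and all three bounds are read off from this. *)
theory Submission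
  imports Defs
begin

text \<open>Without cone points the sum in (iv) is empty, so \<open>a + b\<close> is 0 modulo
  \<open>n\<close>. Then (iii) makes \<open>n\<close> divide \<open>l * (a * b)\<close>, and the
  unit \<open>a * b\<close> cancels.\<close>

lemma sp_data_set_cone_points_nonempty:
  assumes "sp_data_set ((l, n), g0, (a, b), cs)" and "\<not> int n dvd l"
  shows "cs \<noteq> []"
proof
  assume "cs = []"
  with assms(1) have "coprime (a * b) (int n)" and "[a + b = l * (a * b)] (mod int n)"
    and "[a + b = 0] (mod int n)"
    by (simp_all add: mult.assoc)
  then have "int n dvd l * (a * b)"
    by (metis cong_0_iff cong_sym cong_trans)
  with \<open>coprime (a * b) (int n)\<close> have "int n dvd l"
    by (simp add: coprime_commute coprime_dvd_mult_left_iff)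
  with assms(2) show False ..
qed

text \<open>Each cone order satisfies \<open>k \<ge> 2\<close>, so \<open>(k - 1) / k\<close> is at
  least 1/2; the factor 1/2 in the genus turns this into \<open>n / 4\<close> per cone
  point.\<close>

lemma sp_genus_ge:
  assumes "sp_data_set ((l, n), g0, (a, b), cs)"
  shows "real g0 * real n + real (length cs) * (real n / 4) \<le> sp_genus ((l, n), g0, (a, b), cs)"
proof -
  have "real (length cs) * (real n / 2) = (\<Sum>x\<leftarrow>cs. real n / 2)"
    by (simp add: sum_list_triv)
  also have "\<dots> \<le> (\<Sum>(c, k)\<leftarrow>cs. real n / real k * (real k - 1))"
  proof (rule sum_list_mono)
    fix x assume "x \<in> set cs"
    obtain c k where x: "x = (c, k)" by force
    with \<open>x \<in> set cs\<close> assms have "2 \<le> real k" by auto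
    then have "real n / 2 * real k \<le> real n * (real k - 1)"
      using mult_left_mono[of 2 "real k" "real n"] by (simp add: algebra_simps)
    with \<open>2 \<le> real k\<close> have "real n / 2 \<le> real n / real k * (real k - 1)"
      by (simp add: field_simps)
    with x show "real n / 2 \<le> (case x of (c, k) \<Rightarrow> real n / real k * (real k - 1))"
      by simp
  qed
  finally show ?thesis by (simp add: mult.commute)
qed

theorem corollary2p9:
  fixes S :: "'a oriented_surface" and C :: "'a set" and tC h :: "('a \<Rightarrow> 'a) set"
    and g n g0 :: nat and l a b :: int and cs :: "(int \<times> nat) list"
  assumes "g \<ge> 1"
    and "closed_oriented_surface S" and "has_genus (surface_top S) (g + 1)"
    and "simple_closed_curve (surface_top S) C" and "nonseparating (surface_top S) C"
    and "left_dehn_twist S C tC"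
    and "n > 1" and "1 \<le> l" and "l < int n"
    and "fractional_power S tC l n h" and "side_preserving S C h"
    and "given_by_data_set S C h ((l, n), g0, (a, b), cs)"
    and "sp_genus ((l, n), g0, (a, b), cs) = real g"
  shows "n \<le> 4 * g \<and> (g0 \<ge> 1 \<longrightarrow> n < g) \<and> (n > 2 * g \<longrightarrow> length cs = 1)"
proof -
  let ?m = "length cs"
  have data: "sp_data_set ((l, n), g0, (a, b), cs)"
    using assms by simp
  \<comment> \<open>A positive multiple of \<open>n\<close> cannot be smaller than
    \<open>n\<close>.\<close>
  have "\<not> int n dvd l"
    using assms by (simp add: zdvd_not_zless)
  then have "cs \<noteq> []"
    by (rule sp_data_set_cone_points_nonempty[OF data])
  then have "1 \<le> ?m"
    by (simp add: Suc_le_eq)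
  \<comment> \<open>Multiplying by 4 clears the denominators, so the bound transfers to the
    naturals.\<close>
  have "4 * (real g0 * real n) + real ?m * real n \<le> 4 * real g"
    using sp_genus_ge[OF data] unfolding assms(13) by simp
  then have "real (4 * (g0 * n) + ?m * n) \<le> real (4 * g)"
    by simp
  then have bound: "4 * (g0 * n) + ?m * n \<le> 4 * g"
    by (simp only: of_nat_le_iff)
  have m_bound: "1 * n \<le> ?m * n"
    using \<open>1 \<le> ?m\<close> by (rule mult_right_mono) simp
  \<comment> \<open>Here \<open>4 * n + n \<le> 4 * g\<close>, which is strict enough because
    \<open>n\<close> is positive.\<close>
  have "n < g" if "1 \<le> g0"
    using mult_right_mono[OF that, of n] bound m_bound \<open>n > 1\<close> by linarith
  moreover have "?m = 1" if "n > 2 * g"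
  proof (rule ccontr)
    assume "?m \<noteq> 1"
    with \<open>1 \<le> ?m\<close> have "2 \<le> ?m" by simp
    \<comment> \<open>Two cone points would give \<open>2 * n \<le> 4 * g\<close>.\<close>
    from mult_right_mono[OF this, of n] show False
      using bound that by linarith
  qed
  ultimately show ?thesis
    using bound m_bound by linarith
qed

end
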